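(* Let $G_0,G_1\in\mathbb{Z}$ and let $(G_n)_{n\ge0}$ satisfy $G_n=G_{n-1}+G_{n-2}$ for $n\ge2$. Set $\Delta_{G_0,G_1}=\gcd(G_0+G_2,\,G_1+G_3)$. If $k$ is a positive integer with $k\equiv 0,4,8\pmod{12}$, then $$\gcd(G_{k+1}-G_1,\,G_{k+2}-G_2)=\Delta_{G_0,G_1}\cdot F_{k/2}.$$ In particular, $\mathcal{F}(k)=F_{k/2}$, $\mathcal{L}(k)=5F_{k/2}$, and $\mathcal{G}_{G_0,G_1}(k)=\Delta_{G_0,G_1}\cdot F_{k/2}$.
   Context: $F_n$ denotes the Fibonacci numbers ($F_0=0$, $F_1=1$, $F_n=F_{n-1}+F_{n-2}$) and $L_n$ the Lucas numbers ($L_0=2$, $L_1=1$, $L_n=L_{n-1}+L_{n-2}$). For a positive integer $k$, $\mathcal{G}_{G_0,G_1}(k)$ is the greatest common divisor of all integers $\sum_{i=0}^{k-1}G_{n+i}$, $n\ge1$; $\mathcal{F}(k)$ and $\mathcal{L}(k)$ denote this quantity for the Fibonacci sequence ($G_0=0,G_1=1$) and the Lucas sequence ($G_0=2,G_1=1$), respectively. *)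

theory Defs
  imports "HOL-Number_Theory.Number_Theory"
begin

fun gibonacci :: "int \<Rightarrow> int \<Rightarrow> nat \<Rightarrow> int"
  where
    "gibonacci G0 G1 0 = G0"
  | "gibonacci G0 G1 (Suc 0) = G1"
  | "gibonacci G0 G1 (Suc (Suc n)) = gibonacci G0 G1 (Suc n) + gibonacci G0 G1 n"

lemma gibonacci_fib: "gibonacci 0 1 n = int (fib n)"
  by (induction n rule: fib.induct) auto

definition gib_Delta :: "int \<Rightarrow> int \<Rightarrow> int"
  where "gib_Delta G0 G1 =
    gcd (gibonacci G0 G1 0 + gibonacci G0 G1 2) (gibonacci G0 G1 1 + gibonacci G0 G1 3)"

text \<open>The greatest common divisor of all sums of \<open>k\<close> consecutive terms, starting at index
  \<open>n \<ge> 1\<close>. It is nonnegative, and \<open>0\<close> when all these sums vanish.\<close>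

definition gib_sum_gcd :: "int \<Rightarrow> int \<Rightarrow> nat \<Rightarrow> int"
  where "gib_sum_gcd G0 G1 k = Gcd {\<Sum>i<k. gibonacci G0 G1 (n + i) | n. n \<ge> 1}"

definition fib_sum_gcd :: "nat \<Rightarrow> int"
  where "fib_sum_gcd k = gib_sum_gcd 0 1 k"

definition lucas_sum_gcd :: "nat \<Rightarrow> int"
  where "lucas_sum_gcd k = gib_sum_gcd 2 1 k"

end

theory Submission
  imports Defs
begin

text \<open>
  For even \<open>m\<close> every Gibonacci sequence satisfies
  \<open>G\<^bsub>n+2m\<^esub> - G\<^sub>n = F\<^sub>m (G\<^bsub>n+m-1\<^esub> + G\<^bsub>n+m+1\<^esub>)\<close>, a form of
  d'Ocagne's identity. The numbers \<open>G\<^sub>j + G\<^bsub>j+2\<^esub>\<close> satisfy the Fibonacci recurrence too, so the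
  gcd of two consecutive ones does not depend on \<open>j\<close> and equals \<open>\<Delta>\<close>. Take \<open>k = 2m\<close>; a sum of
  \<open>k\<close> consecutive terms telescopes to a difference \<open>G\<^bsub>n+k\<^esub> - G\<^sub>n\<close>.
\<close>

abbreviation gib_outer_sum :: "int \<Rightarrow> int \<Rightarrow> nat \<Rightarrow> int"
  where "gib_outer_sum a b n \<equiv> gibonacci a b n + gibonacci a b (n + 2)"

text \<open>In the induction \<open>n\<close> must vary: one step in \<open>m\<close> is traded for
  a shift of the starting index to \<open>Suc n\<close>.\<close>

lemma gibonacci_add:
  "gibonacci a b (n + m + 1)
     = int (fib (m + 1)) * gibonacci a b (n + 1) + int (fib m) * gibonacci a b n"
proof (induction m arbitrary: n)
  case (Suc m)
  then show ?case
    using Suc.IH[of "Suc n"] by (simp add: algebra_simps)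
qed simp

text \<open>The determinant F_{m+1} G_{r+m+1} - F_m G_{r+m+2} changes sign when m grows by one, and
  equals G_{r+1} at m = 0.\<close>

lemma gibonacci_dOcagne:
  "int (fib (m + 1)) * gibonacci a b (r + m + 1)
     = int (fib m) * gibonacci a b (r + m + 2) + (- 1) ^ m * gibonacci a b (r + 1)"
proof (induction m)
  case (Suc m)
  have "gibonacci a b (r + Suc m + 2) = gibonacci a b (r + Suc m + 1) + gibonacci a b (r + m + 1)"
    by simp
  moreover have "int (fib (Suc m + 1)) = int (fib (m + 1)) + int (fib m)"
    by simp
  ultimately show ?case
    using Suc by (simp add: distrib_left distrib_right)
qed simp

lemma gibonacci_diff_even:
  assumes "even m"
  shows "gibonacci a b (r + 2 * m + 1) - gibonacci a b (r + 1)
           = int (fib m) * gib_outer_sum a b (r + m)"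
proof -
  \<comment> \<open>Expand G_{r+2m+1} by the addition formula at n = r + m, then replace F_{m+1}
    G_{r+m+1} by d'Ocagne; evenness gives G_{r+1} the sign +.\<close>
  have "(- 1 :: int) ^ m = 1" and "r + 2 * m + 1 = r + m + m + 1"
    using assms by simp_all
  then show ?thesis
    using gibonacci_add[of a b "r + m" m] gibonacci_dOcagne[of m a b r]
    by (simp only: mult_1 distrib_left)
qed

lemma gcd_gib_outer_sum:
  "gcd (gib_outer_sum a b n) (gib_outer_sum a b (n + 1)) = gib_Delta a b"
proof (induction n)
  case 0
  show ?case
    by (simp add: gib_Delta_def numeral_3_eq_3 numeral_2_eq_2)
next
  case (Suc n)
  have "gib_outer_sum a b (Suc n + 1) = gib_outer_sum a b (Suc n) + gib_outer_sum a b n"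
    by simp
  then show ?case
    using Suc by (simp only: gcd_add2) (simp add: gcd.commute)
qed

lemma gib_Delta_dvd_gib_outer_sum: "gib_Delta a b dvd gib_outer_sum a b n"
  unfolding gcd_gib_outer_sum[of a b n, symmetric] by (rule gcd_dvd1)

text \<open>Each term G_j is G_{j+2} - G_{j+1}. The right side matches
  \<open>gibonacci_diff_even\<close> with \<open>r = n\<close>.\<close>

lemma sum_gibonacci:
  "(\<Sum>i<k. gibonacci a b (n + i)) = gibonacci a b (n + k + 1) - gibonacci a b (n + 1)"
  by (induction k) simp_all

text \<open>Pulling F_m out of the gcd leaves an absolute value, which disappears because F_m and
  \<Delta> are nonnegative.\<close>

lemma gcd_fib_mult_gib_outer_sum:
  "gcd (int (fib m) * gib_outer_sum a b n) (int (fib m) * gib_outer_sum a b (n + 1))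
     = gib_Delta a b * int (fib m)"
  by (simp only: gcd_mult_left gcd_gib_outer_sum) (simp add: gib_Delta_def abs_mult mult.commute)

lemma gib_sum_gcd_double_even:
  assumes "even m"
  shows "gib_sum_gcd a b (2 * m) = gib_Delta a b * int (fib m)"
proof -
  define S where "S = {\<Sum>i<2 * m. gibonacci a b (n + i) | n. n \<ge> 1}"
  have S: "S = {int (fib m) * gib_outer_sum a b (n + m) | n. n \<ge> 1}"
    unfolding S_def sum_gibonacci gibonacci_diff_even[OF assms] ..
  have "Gcd S = gib_Delta a b * int (fib m)"
  proof (rule zdvd_antisym_nonneg)
    have "int (fib m) * gib_outer_sum a b (n + m) \<in> S" if "n \<ge> 1" for n
      unfolding S using that by blast
    \<comment> \<open>The sums starting at 1 and 2 involve consecutive outer sums, so these two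
      elements of \<open>S\<close> already have gcd \<Delta> F_m.\<close>
    from this[of 1] this[of "1 + 1"]
    have "int (fib m) * gib_outer_sum a b (1 + m) \<in> S"
      and "int (fib m) * gib_outer_sum a b (1 + m + 1) \<in> S"
      by (simp_all only: ac_simps le_add1 order_refl)
    then have "Gcd S dvd gcd (int (fib m) * gib_outer_sum a b (1 + m))
                             (int (fib m) * gib_outer_sum a b (1 + m + 1))"
      by (intro gcd_greatest Gcd_dvd)
    then show "Gcd S dvd gib_Delta a b * int (fib m)"
      by (simp only: gcd_fib_mult_gib_outer_sum)
  next
    show "gib_Delta a b * int (fib m) dvd Gcd S"
    proof (rule Gcd_greatest)
      fix x assume "x \<in> S"
      then obtain n where "x = int (fib m) * gib_outer_sum a b (n + m)"
        unfolding S by blast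
      then show "gib_Delta a b * int (fib m) dvd x"
        using gib_Delta_dvd_gib_outer_sum[of a b "n + m"]
        by (simp only: mult.commute[of "int (fib m)"] mult_dvd_mono dvd_refl)
    qed
  qed (simp_all add: gib_Delta_def)
  then show ?thesis
    by (simp only: gib_sum_gcd_def S_def)
qed

lemma gcd_gibonacci_diff_double_even:
  assumes "even m"
  shows "gcd (gibonacci a b (2 * m + 1) - gibonacci a b 1)
             (gibonacci a b (2 * m + 2) - gibonacci a b 2) = gib_Delta a b * int (fib m)"
proof -
  \<comment> \<open>Taking r = 0 and r = 1 produces the consecutive outer sums at m and m +
    1.\<close>
  have "gibonacci a b (2 * m + 1) - gibonacci a b 1 = int (fib m) * gib_outer_sum a b m"
    using gibonacci_diff_even[OF assms, of a b 0] by (simp only: add_0)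
  moreover have "1 + 2 * m + 1 = 2 * m + 2" and "1 + m = m + 1"
    by simp_all
  then have "gibonacci a b (2 * m + 2) - gibonacci a b 2
      = int (fib m) * gib_outer_sum a b (m + 1)"
    using gibonacci_diff_even[OF assms, of a b 1] by (simp only: one_add_one)
  ultimately show ?thesis
    by (simp only: gcd_fib_mult_gib_outer_sum)
qed

theorem theorem4p7:
  fixes G0 G1 :: int and k :: nat
  assumes "k > 0"
    and "[k = 0] (mod 12) \<or> [k = 4] (mod 12) \<or> [k = 8] (mod 12)"
  shows "gcd (gibonacci G0 G1 (k + 1) - gibonacci G0 G1 1)
             (gibonacci G0 G1 (k + 2) - gibonacci G0 G1 2)
           = gib_Delta G0 G1 * int (fib (k div 2))
       \<and> fib_sum_gcd k = int (fib (k div 2))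
       \<and> lucas_sum_gcd k = 5 * int (fib (k div 2))
       \<and> gib_sum_gcd G0 G1 k = gib_Delta G0 G1 * int (fib (k div 2))"
proof -
  \<comment> \<open>As 4 divides 12, divisibility by 4 can be read off the residue; it makes k / 2
    even.\<close>
  from assms(2) have "4 dvd k"
    by (elim disjE; simp add: cong_dvd_iff[OF cong_dvd_modulus_nat, of _ _ 12 4])
  then obtain j where "k = 4 * j" ..
  define m where "m = 2 * j"
  have k: "k = 2 * m" and m: "even m"
    using \<open>k = 4 * j\<close> by (simp_all add: m_def)
  \<comment> \<open>These are gcd(0 + 1, 1 + 2) for Fibonacci and gcd(2 + 3, 1 + 4) for
    Lucas.\<close>
  have "gib_Delta 0 1 = 1" "gib_Delta 2 1 = 5"
    by (simp_all add: gib_Delta_def numeral_3_eq_3 numeral_2_eq_2)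
  moreover have "k div 2 = m"
    by (simp add: k)
  ultimately show ?thesis
    unfolding fib_sum_gcd_def lucas_sum_gcd_def
    using gcd_gibonacci_diff_double_even[OF m, of G0 G1] gib_sum_gcd_double_even[OF m]
    by (simp only: k mult_1 simp_thms)
qed

end
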